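(* Let $V$ be a real separable Hilbert space and let $a,b,m$ be symmetric bilinear forms on $V$ such that $a$ is continuous and $V$-coercive, $b$ is weakly continuous, and $m$ is weakly continuous with $m(u,u)>0$ for all nonzero $u\in V$. Let $\mu_*\in\mathbb{R}$ with $\mu_*\notin\sigma(a,m)$ and let $(\lambda_i,\mu_* )$, $1\le i\le k$, be distinct eigenpoints in $\sigma(a,b,m)$, with $k\ge2$. If $e_i$ is an eigenvector of $(a,b,m)$ associated with $(\lambda_i,\mu_* )$ for each $1\le i\le k$, then the set $\{e_1,\dots,e_k\}$ is linearly independent.
   Context: "$a$ is continuous and $V$-coercive" means there are constants $0<\kappa_1\le\kappa_2<\infty$ with $\kappa_1\|u\|^2\le a(u,u)\le\kappa_2\|u\|^2$ for all $u\in V$. A symmetric bilinear form $b$ on $V$ is weakly continuous if $u_j\rightharpoonup u$ and $v_j\rightharpoonup v$ weakly in $V$ imply $b(u_j,v_j)\to b(u,v)$. A pair $(\lambda,\mu)\in\mathbb{R}^2$ is an eigenpoint of $(a,b,m)$ if there is a nonzero $u\in V$ (an eigenvector corresponding to $(\lambda,\mu)$) with $a(u,v)=\lambda\,b(u,v)+\mu\,m(u,v)$ for all $v\in V$; $\sigma(a,b,m)$ is the set of all eigenpoints. $\sigma(a,m)$ is the set of $\mu\in\mathbb{R}$ for which there is a nonzero $u\in V$ with $a(u,v)=\mu\,m(u,v)$ for all $v\in V$. *)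

theory Defs
  imports "HOL-Analysis.Analysis"
begin

definition symmetric_bilinear_form :: "('a::real_vector \<Rightarrow> 'a \<Rightarrow> real) \<Rightarrow> bool" where
  "symmetric_bilinear_form f \<longleftrightarrow> bilinear f \<and> (\<forall>u v. f u v = f v u)"

(* Continuity of a is expressed through its quadratic form: for a symmetric bilinear form
   with the lower bound, the upper bound holds iff the form is bounded. *)
definition continuous_coercive :: "('a::real_normed_vector \<Rightarrow> 'a \<Rightarrow> real) \<Rightarrow> bool" where
  "continuous_coercive a \<longleftrightarrow>
     (\<exists>\<kappa>\<^sub>1 \<kappa>\<^sub>2. 0 < \<kappa>\<^sub>1 \<and> \<kappa>\<^sub>1 \<le> \<kappa>\<^sub>2 \<and>
        (\<forall>u. \<kappa>\<^sub>1 * (norm u)\<^sup>2 \<le> a u u \<and> a u u \<le> \<kappa>\<^sub>2 * (norm u)\<^sup>2))"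

definition weakly_converges :: "(nat \<Rightarrow> 'a::real_normed_vector) \<Rightarrow> 'a \<Rightarrow> bool" where
  "weakly_converges X x \<longleftrightarrow>
     (\<forall>\<phi> :: 'a \<Rightarrow> real. bounded_linear \<phi> \<longrightarrow> (\<lambda>j. \<phi> (X j)) \<longlonglongrightarrow> \<phi> x)"

definition weakly_continuous_form :: "('a::real_normed_vector \<Rightarrow> 'a \<Rightarrow> real) \<Rightarrow> bool" where
  "weakly_continuous_form f \<longleftrightarrow>
     (\<forall>X Y x y. weakly_converges X x \<longrightarrow> weakly_converges Y y \<longrightarrow>
        (\<lambda>j. f (X j) (Y j)) \<longlonglongrightarrow> f x y)"

definition is_eigenvector ::
  "('a::real_vector \<Rightarrow> 'a \<Rightarrow> real) \<Rightarrow> ('a \<Rightarrow> 'a \<Rightarrow> real) \<Rightarrow> ('a \<Rightarrow> 'a \<Rightarrow> real) \<Rightarrow> real \<times> real \<Rightarrow> 'a \<Rightarrow> bool" where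
  "is_eigenvector a b m p u \<longleftrightarrow>
     u \<noteq> 0 \<and> (\<forall>v. a u v = fst p * b u v + snd p * m u v)"

definition eigenpoints ::
  "('a::real_vector \<Rightarrow> 'a \<Rightarrow> real) \<Rightarrow> ('a \<Rightarrow> 'a \<Rightarrow> real) \<Rightarrow> ('a \<Rightarrow> 'a \<Rightarrow> real) \<Rightarrow> (real \<times> real) set" where
  "eigenpoints a b m = {p. \<exists>u. is_eigenvector a b m p u}"

definition eigenvalues ::
  "('a::real_vector \<Rightarrow> 'a \<Rightarrow> real) \<Rightarrow> ('a \<Rightarrow> 'a \<Rightarrow> real) \<Rightarrow> real set" where
  "eigenvalues a m = {\<mu>. \<exists>u. u \<noteq> 0 \<and> (\<forall>v. a u v = \<mu> * m u v)}"

end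

theory Submission
  imports Defs
begin

text \<open>
  Put $f = a - \mu m$. The hypothesis that \<open>\<mu>\<close> is not in the spectrum of \<open>(a, m)\<close> says exactly that
  \<open>f\<close> is nondegenerate, and the eigenvectors \<open>e\<^sub>i\<close> are those of the linear pencil
  $f(u, \cdot) = \lambda\, b(u, \cdot)$. Nondegeneracy forces \<open>\<lambda>\<^sub>i \<noteq> 0\<close>, so $b(e_i, \cdot)$ can be
  recovered from $f(e_i, \cdot)$. One would like to say that the \<open>e\<^sub>i\<close> are eigenvectors, with distinct
  eigenvalues \<open>1/\<lambda>\<^sub>i\<close>, of an operator \<open>T\<close> with $f(Tu, \cdot) = b(u, \cdot)$. Such a \<open>T\<close> need only act
  on the span of the \<open>e\<^sub>i\<close>, so the classical elimination argument runs directly on the forms: a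
  linear relation among the \<open>e\<^sub>i\<close> is transformed into a shorter one by means of \<open>f\<close> and \<open>b\<close>, and
  nondegeneracy converts the resulting identity of functionals back into a relation among vectors.
\<close>

text \<open>
  Given a relation $\sum c_i e_i = 0$ containing the index \<open>j\<close>, apply both $f(\cdot, v)$ and
  $l_j b(\cdot, v)$ to it and subtract: the term of \<open>j\<close> cancels, and what remains is
  $f(\sum c_i (1 - l_j / l_i) e_i, v) = 0$. As the \<open>l\<^sub>i\<close> are distinct, the factors
  $1 - l_j / l_i$ with \<open>i \<noteq> j\<close> are nonzero, so the shorter relation still controls the
  original coefficients.
\<close>

lemma pencil_eigenvectors_no_relation:
  fixes f b :: "'v::real_vector \<Rightarrow> 'v \<Rightarrow> real"
  assumes lin_f: "\<And>v. linear (\<lambda>u. f u v)" and lin_b: "\<And>v. linear (\<lambda>u. b u v)"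
    and nondeg: "\<And>u. (\<And>v. f u v = 0) \<Longrightarrow> u = 0"
    and "finite I" and "inj_on l I"
    and "\<And>i v. i \<in> I \<Longrightarrow> f (e i) v = l i * b (e i) v"
    and "\<And>i. i \<in> I \<Longrightarrow> e i \<noteq> 0"
    and "(\<Sum>i\<in>I. c i *\<^sub>R e i) = 0"
  shows "\<forall>i\<in>I. c i = 0"
  using assms(4-)
proof (induction I arbitrary: c rule: finite_induct)
  case empty
  then show ?case by simp
next
  case (insert j I)
  have eig: "f (e i) v = l i * b (e i) v" if "i \<in> insert j I" for i v
    using insert.prems(2) that by blast
  have nz: "e i \<noteq> 0" if "i \<in> insert j I" for i
    using insert.prems(3) that by blast
  have l_nz: "l i \<noteq> 0" if "i \<in> insert j I" for i
  proof
    assume "l i = 0"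
    then have "f (e i) v = 0" for v
      using eig[OF that] by simp
    then show False
      using nondeg nz[OF that] by blast
  qed
  have l_ne: "l i \<noteq> l j" if "i \<in> I" for i
    using insert.prems(1) insert.hyps(2) that by (auto simp: inj_on_def)
  define d where "d i = c i * (1 - l j / l i)" for i
  have "f (\<Sum>i\<in>I. d i *\<^sub>R e i) v = 0" for v
  proof -
    have f0: "(\<Sum>i\<in>insert j I. c i * f (e i) v) = 0"
      using arg_cong[OF insert.prems(4), of "\<lambda>u. f u v"]
      by (simp only: linear_sum[OF lin_f] linear_scale[OF lin_f] linear_0[OF lin_f] real_scaleR_def)
    have b0: "(\<Sum>i\<in>insert j I. c i * b (e i) v) = 0"
      using arg_cong[OF insert.prems(4), of "\<lambda>u. b u v"]
      by (simp only: linear_sum[OF lin_b] linear_scale[OF lin_b] linear_0[OF lin_b] real_scaleR_def)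
    have "f (\<Sum>i\<in>I. d i *\<^sub>R e i) v = (\<Sum>i\<in>I. d i * f (e i) v)"
      by (simp add: linear_sum[OF lin_f] linear_scale[OF lin_f])
    \<comment> \<open>The coefficient \<open>d j\<close> vanishes, so \<open>j\<close> may be put back.\<close>
    also have "\<dots> = (\<Sum>i\<in>insert j I. d i * f (e i) v)"
      using insert.hyps l_nz[of j] by (simp add: d_def)
    also have "\<dots> = (\<Sum>i\<in>insert j I. c i * f (e i) v - l j * (c i * b (e i) v))"
    proof (rule sum.cong[OF refl])
      fix i assume i: "i \<in> insert j I"
      show "d i * f (e i) v = c i * f (e i) v - l j * (c i * b (e i) v)"
        using l_nz[OF i] by (simp add: eig[OF i] d_def field_simps)
    qed
    also have "\<dots> = 0"
      by (simp only: sum_subtractf sum_distrib_left[symmetric] f0 b0 mult_zero_right diff_self)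
    finally show ?thesis .
  qed
  then have "(\<Sum>i\<in>I. d i *\<^sub>R e i) = 0"
    by (rule nondeg)
  then have "\<forall>i\<in>I. d i = 0"
    using insert.IH[of d] inj_on_subset[OF insert.prems(1) subset_insertI] eig nz by blast
  then have c_I: "\<forall>i\<in>I. c i = 0"
    using l_ne l_nz by (fastforce simp: d_def)
  then have "c j *\<^sub>R e j = 0"
    using insert.prems(4) insert.hyps by simp
  then show ?case
    using c_I nz[of j] by simp
qed

text \<open>
  A coincidence $e_i = e_j$ with \<open>i \<noteq> j\<close> would make $b(e_i, \cdot)$, and with it
  $f(e_i, \cdot)$, vanish. So the family is injective, and a relation among the members of its image
  is a relation among the indexed vectors.
\<close>

lemma pencil_eigenvectors_independent:
  fixes f b :: "'v::real_vector \<Rightarrow> 'v \<Rightarrow> real"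
  assumes lin_f: "\<And>v. linear (\<lambda>u. f u v)" and lin_b: "\<And>v. linear (\<lambda>u. b u v)"
    and nondeg: "\<And>u. (\<And>v. f u v = 0) \<Longrightarrow> u = 0"
    and "finite I" and inj: "inj_on l I"
    and eig: "\<And>i v. i \<in> I \<Longrightarrow> f (e i) v = l i * b (e i) v"
    and nz: "\<And>i. i \<in> I \<Longrightarrow> e i \<noteq> 0"
  shows "inj_on e I \<and> independent (e ` I)"
proof
  show inj_e: "inj_on e I"
  proof (rule inj_onI, rule ccontr)
    fix i j assume ij: "i \<in> I" "j \<in> I" "e i = e j" "i \<noteq> j"
    then have "l i \<noteq> l j"
      using inj by (auto simp: inj_on_def)
    have "b (e i) v = 0" for v
    proof -
      have "l i * b (e i) v = l j * b (e i) v"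
        using eig[OF ij(1), of v] eig[OF ij(2), of v, folded ij(3)] by (rule trans[OF sym])
      then show ?thesis
        using \<open>l i \<noteq> l j\<close> by simp
    qed
    then have "f (e i) v = 0" for v
      using eig[OF ij(1)] by simp
    then show False
      using nondeg nz ij(1) by blast
  qed
  show "independent (e ` I)"
  proof (rule independent_if_scalars_zero)
    fix g x assume "(\<Sum>x\<in>e ` I. g x *\<^sub>R x) = 0" and x: "x \<in> e ` I"
    then have "(\<Sum>i\<in>I. g (e i) *\<^sub>R e i) = 0"
      by (simp add: sum.reindex[OF inj_e])
    then have "\<forall>i\<in>I. g (e i) = 0"
      using pencil_eigenvectors_no_relation[of f b I l e "\<lambda>i. g (e i)"] assms by blast
    then show "g x = 0"
      using x by blast
  qed (use \<open>finite I\<close> in simp)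
qed

theorem theorem9p1:
  fixes a b m :: "'v::{real_inner, complete_space} \<Rightarrow> 'v \<Rightarrow> real"
    and \<mu> :: real and l :: "nat \<Rightarrow> real" and e :: "nat \<Rightarrow> 'v" and k :: nat
  assumes "separable_space (euclidean :: 'v topology)"
    and "symmetric_bilinear_form a" and "symmetric_bilinear_form b" and "symmetric_bilinear_form m"
    and "continuous_coercive a"
    and "weakly_continuous_form b"
    and "weakly_continuous_form m"
    and "\<And>u. u \<noteq> 0 \<Longrightarrow> m u u > 0"
    and "\<mu> \<notin> eigenvalues a m"
    and "k \<ge> 2"
    and "inj_on (\<lambda>i. (l i, \<mu>)) {1..k}"
    and "\<And>i. i \<in> {1..k} \<Longrightarrow> (l i, \<mu>) \<in> eigenpoints a b m"
    and "\<And>i. i \<in> {1..k} \<Longrightarrow> is_eigenvector a b m (l i, \<mu>) (e i)"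
  shows "inj_on e {1..k} \<and> independent (e ` {1..k})"
proof (rule pencil_eigenvectors_independent)
  have bil: "bilinear a" "bilinear b" "bilinear m"
    using assms(2-4) by (simp_all add: symmetric_bilinear_form_def)
  show "linear (\<lambda>u. a u v - \<mu> * m u v)" for v
    using bil linear_compose_scale_right[of "\<lambda>u. m u v" \<mu>]
    by (intro linear_compose_sub) (simp_all add: bilinear_def)
  show "linear (\<lambda>u. b u v)" for v
    using bil by (simp add: bilinear_def)
  show "u = 0" if "\<And>v. a u v - \<mu> * m u v = 0" for u
  proof -
    have "\<forall>v. a u v = \<mu> * m u v"
      using that by simp
    then show ?thesis
      using assms(9) by (auto simp: eigenvalues_def)
  qed
  show "inj_on l {1..k}"
    using assms(11) unfolding inj_on_def prod.inject by blast
  show "a (e i) v - \<mu> * m (e i) v = l i * b (e i) v" and "e i \<noteq> 0" if "i \<in> {1..k}" for i v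
    using assms(13)[OF that] by (simp_all add: is_eigenvector_def)
qed simp

end
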